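(* Let $(E,T,S,e)$ be a conditional expectation preserving system. Then $(E,T,S,e)$ is ergodic if and only if, for every component $p$ of $e$, $Sp=p$ implies $Tp=p$.
   Context: A conditional Riesz triple $(E,e,T)$ consists of a Dedekind complete Riesz space $E$, a weak order unit $e$ of $E$, and a conditional expectation operator $T$ on $E$, that is, a strictly positive order continuous linear projection $T:E\to E$ with $Te=e$ and Dedekind complete range $R(T)$. A conditional expectation preserving system is a 4-tuple $(E,T,S,e)$ where $(E,e,T)$ is a conditional Riesz triple and $S:E\to E$ is an order continuous Riesz (lattice) homomorphism with $Se=e$ and $TSf=Tf$ for all $f\in E$. The system is called ergodic if, for every $f\in E$, $Sf=f$ implies $Tf=f$. A component of $e$ is an element $p\in E$ with $p\wedge(e-p)=0$. *)

theory Defs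
  imports Complex_Main "HOL-Library.Lattice_Algebras" "HOL-Library.Lub_Glb"
begin

class riesz_space = ordered_real_vector + lattice_ab_group_add_abs

text \<open>
  In \<^class>\<open>conditionally_complete_lattice\<close>, \<^const>\<open>Sup\<close> and \<^const>\<open>Inf\<close> are constrained only on
  nonempty sets that are bounded above, respectively below, so they can be chosen on every
  Dedekind complete Riesz space.
\<close>

class dedekind_complete_riesz_space = riesz_space + conditionally_complete_lattice

definition decreases_to_zero :: "'a::dedekind_complete_riesz_space set \<Rightarrow> bool" where
  "decreases_to_zero D \<longleftrightarrow>
     D \<noteq> {} \<and> (\<forall>a\<in>D. \<forall>b\<in>D. \<exists>c\<in>D. c \<le> a \<and> c \<le> b) \<and> bdd_below D \<and> Inf D = 0"

text \<open>
  Order convergence along a filter. A net \<open>f\<close> on a directed set is covered by letting \<open>F\<close> be the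
  filter generated by the tails of that set.
\<close>

definition order_converges ::
    "('i \<Rightarrow> 'a::dedekind_complete_riesz_space) \<Rightarrow> 'a \<Rightarrow> 'i filter \<Rightarrow> bool" where
  "order_converges f l F \<longleftrightarrow>
     (\<exists>D. decreases_to_zero D \<and> (\<forall>d\<in>D. eventually (\<lambda>i. \<bar>f i - l\<bar> \<le> d) F))"

text \<open>
  Since \<open>order_converges f l F\<close> is the same as \<open>order_converges (\<lambda>x. x) l (filtermap f F)\<close>, it is
  enough to quantify over filters on the space itself; this captures nets over all index sets
  without quantifying over index types.
\<close>

definition order_continuous ::
    "('a::dedekind_complete_riesz_space \<Rightarrow> 'b::dedekind_complete_riesz_space) \<Rightarrow> bool" where
  "order_continuous T \<longleftrightarrow>
     (\<forall>F l. order_converges (\<lambda>x. x) l F \<longrightarrow> order_converges T (T l) F)"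

definition weak_order_unit :: "'a::riesz_space \<Rightarrow> bool" where
  "weak_order_unit e \<longleftrightarrow> 0 \<le> e \<and> (\<forall>x. inf \<bar>x\<bar> e = 0 \<longrightarrow> x = 0)"

definition strictly_positive :: "('a::riesz_space \<Rightarrow> 'b::riesz_space) \<Rightarrow> bool" where
  "strictly_positive T \<longleftrightarrow> (\<forall>x>0. T x > 0)"

definition riesz_homomorphism :: "('a::riesz_space \<Rightarrow> 'b::riesz_space) \<Rightarrow> bool" where
  "riesz_homomorphism S \<longleftrightarrow> linear S \<and> (\<forall>x y. S (sup x y) = sup (S x) (S y))"

text \<open>
  Dedekind completeness of a subset in its own order: both the bounds and the suprema
  are taken inside \<open>R\<close>.
\<close>

definition dedekind_complete_subset :: "'a::order set \<Rightarrow> bool" where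
  "dedekind_complete_subset R \<longleftrightarrow>
     (\<forall>A. A \<subseteq> R \<and> A \<noteq> {} \<and> (\<exists>u. isUb R A u) \<longrightarrow> (\<exists>s. isLub R A s))"

definition component_of :: "'a::riesz_space \<Rightarrow> 'a \<Rightarrow> bool" where
  "component_of e p \<longleftrightarrow> inf p (e - p) = 0"

locale conditional_riesz_triple =
  fixes e :: "'a::dedekind_complete_riesz_space" and T :: "'a \<Rightarrow> 'a"
  assumes weak_order_unit: "weak_order_unit e"
    and T_linear: "linear T"
    and T_strictly_positive: "strictly_positive T"
    and T_order_continuous: "order_continuous T"
    and T_projection: "T \<circ> T = T"
    and T_unit: "T e = e"
    and T_range: "dedekind_complete_subset (range T)"

locale cond_exp_preserving_system =
  conditional_riesz_triple e T
  for T S :: "'a::dedekind_complete_riesz_space \<Rightarrow> 'a" and e :: 'a +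
  assumes S_homomorphism: "riesz_homomorphism S"
    and S_order_continuous: "order_continuous S"
    and S_unit: "S e = e"
    and S_preserves: "T (S f) = T f"

definition ergodic ::
    "('a::dedekind_complete_riesz_space \<Rightarrow> 'a) \<Rightarrow> ('a \<Rightarrow> 'a) \<Rightarrow> bool" where
  "ergodic T S \<longleftrightarrow> (\<forall>f. S f = f \<longrightarrow> T f = f)"

end

theory Submission
  imports Defs
begin

text \<open>
  By strict positivity, \<open>f \<le> T f\<close> already forces \<open>T f = f\<close>, because \<open>T (T f - f) = 0\<close>; likewise
  \<open>p \<le> S p\<close> forces \<open>S p = p\<close>, because \<open>T (S p - p) = 0\<close>. Let \<open>f\<close> be invariant; passing to
  \<open>f\<^sup>+\<close> and \<open>f\<^sup>-\<close> we may assume \<open>f \<ge> 0\<close>. Put \<open>d = e/m\<close> and cut \<open>f \<sqinter> K d\<close> into the slices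
  \<open>g\<^sub>k = (f - k d)\<^sup>+ \<sqinter> d\<close>, \<open>k < K\<close>. If \<open>p\<^sub>k\<close> is the component of \<open>e\<close> carried by the band of
  \<open>(f - k d)\<^sup>+\<close>, then \<open>p\<^sub>k\<^sub>+\<^sub>1 \<le> m g\<^sub>k \<le> p\<^sub>k\<close>. Each \<open>p\<^sub>k\<close> is invariant, hence fixed by \<open>T\<close>, and
  summing the slices gives \<open>f \<sqinter> K d \<le> d + T f\<close>. Letting \<open>K\<close> and then \<open>m\<close> grow yields \<open>f \<le> T f\<close>.
\<close>

text \<open>Keeps differences such as \<open>f - inf f u\<close> intact; the simplifier would turn
  them into suprema of negatives.\<close>

declare neg_inf_eq_sup [simp del] diff_inf_eq_sup [simp del]
declare neg_sup_eq_inf [simp del] diff_sup_eq_inf [simp del]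

lemma scaleR_inf:
  fixes x y :: "'a::riesz_space"
  assumes "0 \<le> r"
  shows "r *\<^sub>R inf x y = inf (r *\<^sub>R x) (r *\<^sub>R y)"
proof (cases "r = 0")
  case False
  with assms have r: "0 < r" by simp
  show ?thesis
  proof (rule order.antisym)
    show "r *\<^sub>R inf x y \<le> inf (r *\<^sub>R x) (r *\<^sub>R y)"
      using assms by (simp add: scaleR_left_mono)
    have "inverse r *\<^sub>R inf (r *\<^sub>R x) (r *\<^sub>R y) \<le> inf x y"
    proof (rule le_infI)
      show "inverse r *\<^sub>R inf (r *\<^sub>R x) (r *\<^sub>R y) \<le> x"
        using scaleR_left_mono[OF inf_le1[of "r *\<^sub>R x" "r *\<^sub>R y"], of "inverse r"] r by simp
      show "inverse r *\<^sub>R inf (r *\<^sub>R x) (r *\<^sub>R y) \<le> y"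
        using scaleR_left_mono[OF inf_le2[of "r *\<^sub>R x" "r *\<^sub>R y"], of "inverse r"] r by simp
    qed
    from scaleR_left_mono[OF this assms]
    show "inf (r *\<^sub>R x) (r *\<^sub>R y) \<le> r *\<^sub>R inf x y" using r by simp
  qed
qed simp

lemma sup_diff_zero:
  fixes x y :: "'a::riesz_space"
  shows "sup (x - y) 0 = x - inf x y"
  using add_sup_distrib_left[of x "- x" "- y"] by (simp add: diff_inf_eq_sup sup.commute)

text \<open>The supremum of the multiples of \<open>x\<close> stays an upper bound after subtracting
  \<open>x\<close>, since each \<open>n\<close> can be replaced by \<open>n + 1\<close>.\<close>

lemma archimedean:
  fixes x y :: "'a::dedekind_complete_riesz_space"
  assumes "\<And>n. real n *\<^sub>R x \<le> y"
  shows "x \<le> 0"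
proof -
  let ?s = "SUP n. real n *\<^sub>R x"
  have bdd: "bdd_above (range (\<lambda>n. real n *\<^sub>R x))"
    using assms by (auto intro!: bdd_aboveI[of _ y])
  have "real n *\<^sub>R x \<le> ?s - x" for n
    using cSUP_upper[OF UNIV_I bdd, of "Suc n"] by (simp add: algebra_simps)
  then have "?s \<le> ?s - x" by (intro cSUP_least) auto
  then show ?thesis by simp
qed

text \<open>The weak unit detects any excess of \<open>f\<close> over \<open>u\<close>: all
  multiples of its part \<open>c\<close> below \<open>e\<close> fit under \<open>f\<close>, so
  \<open>c = 0\<close>.\<close>

lemma le_of_truncations_le:
  fixes e f u :: "'a::dedekind_complete_riesz_space"
  assumes e: "weak_order_unit e" and f: "0 \<le> f"
    and le: "\<And>n. inf f (real n *\<^sub>R e) \<le> u"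
  shows "f \<le> u"
proof -
  define v where "v = inf u f"
  define c where "c = inf (f - v) e"
  have e0: "0 \<le> e" using e by (simp add: weak_order_unit_def)
  have c0: "0 \<le> c" by (simp add: c_def v_def e0)
  \<comment> \<open>One more copy of \<open>c\<close> always fits: the truncation lies below
    \<open>v\<close>, which leaves a gap of at least \<open>c\<close> under \<open>f\<close>, and
    \<open>c \<le> e\<close> pays for the next multiple of \<open>e\<close>.\<close>
  have "real n *\<^sub>R c \<le> inf f (real n *\<^sub>R e)" for n
  proof (induction n)
    case (Suc n)
    have "inf f (real n *\<^sub>R e) \<le> v"
      using le by (simp add: v_def)
    then have "c \<le> f - inf f (real n *\<^sub>R e)"
      unfolding c_def by (blast intro: le_infI1 diff_left_mono)
    moreover have "c \<le> (1 + real n) *\<^sub>R e - inf f (real n *\<^sub>R e)"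
    proof -
      have "c \<le> e" by (simp add: c_def)
      also have "e = (1 + real n) *\<^sub>R e - real n *\<^sub>R e" by (simp add: algebra_simps)
      also have "\<dots> \<le> (1 + real n) *\<^sub>R e - inf f (real n *\<^sub>R e)"
        by (intro diff_left_mono inf_le2)
      finally show ?thesis .
    qed
    ultimately have "c + inf f (real n *\<^sub>R e) \<le> inf f (real (Suc n) *\<^sub>R e)"
      by (simp only: le_diff_eq of_nat_Suc le_inf_iff)
    with add_left_mono[OF Suc, of c] show ?case
      unfolding of_nat_Suc scaleR_add_left scaleR_one by (rule order_trans)
  qed (use f in simp)
  then have "real n *\<^sub>R c \<le> f" for n by (meson le_infE)
  then have "c = 0" using archimedean c0 by (metis order.antisym)
  moreover have "\<bar>f - v\<bar> = f - v" by (simp add: v_def)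
  ultimately have "f - v = 0" using e unfolding weak_order_unit_def c_def by metis
  then show ?thesis by (simp add: v_def inf.absorb_iff2)
qed

text \<open>For nonnegative \<open>e\<close> and \<open>h\<close> this is the projection of
  \<open>e\<close> onto the band generated by \<open>h\<close>.\<close>

definition band_component ::
    "'a::dedekind_complete_riesz_space \<Rightarrow> 'a \<Rightarrow> 'a" where
  "band_component e h = (SUP n. inf (real n *\<^sub>R h) e)"

lemma band_component_upper: "inf (real n *\<^sub>R h) e \<le> band_component e h"
  unfolding band_component_def
  by (rule cSUP_upper) (auto intro: bdd_aboveI[of _ e])

lemma band_component_least:
  assumes "\<And>n. inf (real n *\<^sub>R h) e \<le> u"
  shows "band_component e h \<le> u"
  unfolding band_component_def using assms by (intro cSUP_least) auto

lemma component_of_band_component: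
  assumes e: "0 \<le> e"
  shows "component_of e (band_component e h)"
proof -
  define a where "a n = inf (real n *\<^sub>R h) e" for n
  define p where "p = band_component e h"
  have a_le: "a n \<le> p" for n
    unfolding a_def p_def by (rule band_component_upper)
  have p_le: "p \<le> e"
    unfolding p_def by (rule band_component_least) simp
  have p0: "0 \<le> p" using a_le[of 0] e by (simp add: a_def inf.absorb1)
  \<comment> \<open>A common part of \<open>a m\<close> and \<open>e - p\<close> can be added to any
    \<open>a n\<close> without leaving \<open>a (n + m) \<le> p\<close>, so \<open>p\<close> minus
    that part still bounds every \<open>a n\<close>.\<close>
  have disj: "inf (a m) (e - p) \<le> 0" for m
  proof -
    let ?c = "inf (a m) (e - p)"
    have "a n \<le> p - ?c" for n
    proof -
      have "a n + ?c \<le> real n *\<^sub>R h + real m *\<^sub>R h"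
        unfolding a_def by (intro add_mono) (simp_all add: le_infI1)
      moreover have "a n + ?c \<le> p + (e - p)"
        by (intro add_mono a_le) simp
      ultimately have "a n + ?c \<le> inf (real (n + m) *\<^sub>R h) e"
        by (simp add: scaleR_add_left)
      also have "\<dots> \<le> p"
        unfolding p_def by (rule band_component_upper)
      finally show ?thesis by (simp only: le_diff_eq)
    qed
    then have "p \<le> p - ?c"
      unfolding a_def p_def by (rule band_component_least)
    then show ?thesis by simp
  qed
  let ?c = "inf p (e - p)"
  \<comment> \<open>Replacing \<open>p\<close> by \<open>a m\<close> lowers the infimum with
    \<open>e - p\<close> by at most \<open>p - a m\<close>; this carries disjointness over to the
    supremum.\<close>
  have "a m \<le> p - ?c" for m
  proof -
    have "?c - (p - a m) \<le> inf (a m) (e - p)"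
    proof (rule le_infI)
      show "?c - (p - a m) \<le> a m" by (simp add: diff_le_eq)
      have "?c - (p - a m) \<le> ?c"
        using a_le by (simp only: diff_le_eq le_add_same_cancel1 diff_ge_0_iff_ge)
      then show "?c - (p - a m) \<le> e - p" by (rule order_trans) simp
    qed
    with disj[of m] have "?c - (p - a m) \<le> 0" by (rule order_trans[rotated])
    then show ?thesis by (simp only: diff_le_0_iff_le le_diff_eq add.commute)
  qed
  then have "p \<le> p - ?c"
    unfolding a_def p_def by (rule band_component_least)
  then have "?c \<le> 0" by simp
  moreover have "0 \<le> ?c" using p0 p_le by simp
  ultimately show ?thesis
    unfolding component_of_def p_def by (rule order.antisym)
qed

text \<open>The left side is the term \<open>n = m\<close> of the supremum.\<close>

lemma scaleR_slice_le_band_component: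
  "real m *\<^sub>R inf h d \<le> band_component (real m *\<^sub>R d) h"
  by (metis band_component_upper scaleR_inf of_nat_0_le_iff)

text \<open>The positive parts of \<open>h - d\<close> and \<open>d - h\<close> are disjoint, and so
  are their multiples. Hence \<open>?q\<close> and \<open>m\<close> times the second part, both
  below \<open>m\<close> times \<open>d\<close>, have a sum below it too.\<close>

lemma band_component_le_scaleR_slice:
  assumes h: "0 \<le> h" and d: "0 \<le> d"
  shows "band_component (real m *\<^sub>R d) (sup (h - d) 0) \<le> real m *\<^sub>R inf h d"
proof (rule band_component_least)
  fix n
  let ?y = "sup (h - d) 0" and ?z = "sup (d - h) 0"
  let ?q = "inf (real n *\<^sub>R ?y) (real m *\<^sub>R d)"
  let ?N = "real (max n m)"
  have z: "?z = d - inf h d"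
    by (simp only: sup_diff_zero inf.commute)
  have "?y = h - inf h d"
    by (rule sup_diff_zero)
  then have yz: "inf ?y ?z = 0"
    unfolding z using add_inf_distrib_right[of h d "- inf h d"] by simp
  \<comment> \<open>Raising both coefficients to a common one lets \<open>scaleR_inf\<close> pull it
    out.\<close>
  have "inf ?q (real m *\<^sub>R ?z) \<le> inf (?N *\<^sub>R ?y) (?N *\<^sub>R ?z)"
    by (intro inf_mono le_infI1 scaleR_right_mono) auto
  also have "\<dots> = 0"
    using yz by (simp flip: scaleR_inf)
  finally have "inf ?q (real m *\<^sub>R ?z) \<le> 0" .
  then have "?q + real m *\<^sub>R ?z \<le> sup ?q (real m *\<^sub>R ?z)"
    by (subst add_eq_inf_sup) simp
  also have "\<dots> \<le> real m *\<^sub>R d"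
    by (intro le_supI inf_le2 scaleR_left_mono) (use h d in auto)
  finally have "?q \<le> real m *\<^sub>R d - real m *\<^sub>R ?z" by (simp only: le_diff_eq)
  then show "?q \<le> real m *\<^sub>R inf h d" by (simp add: z scaleR_diff_right)
qed

text \<open>Telescoping: slice \<open>k\<close> is the increment from \<open>inf f (k d)\<close> to
  \<open>inf f ((k + 1) d)\<close>.\<close>

lemma sum_slices:
  fixes f d :: "'a::riesz_space"
  assumes f: "0 \<le> f" and d: "0 \<le> d"
  shows "(\<Sum>k<K. inf (sup (f - real k *\<^sub>R d) 0) d) = inf f (real K *\<^sub>R d)"
proof (induction K)
  case (Suc K)
  let ?a = "real K *\<^sub>R d"
  have "sup (f - ?a) 0 = f - inf f ?a"
    by (rule sup_diff_zero)
  then have "inf f ?a + inf (sup (f - ?a) 0) d = inf f (inf f ?a + d)"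
    by (simp add: add_inf_distrib_left)
  also have "\<dots> = inf f (inf (f + d) (?a + d))"
    by (simp add: add_inf_distrib_right)
  also have "\<dots> = inf f (?a + d)"
    using d by (metis inf_assoc inf.absorb1 le_add_same_cancel1)
  finally show ?case
    using Suc by (simp add: algebra_simps)
qed (use f in \<open>simp add: inf.absorb2\<close>)

lemma riesz_homomorphism_mono:
  assumes "riesz_homomorphism S" "x \<le> y"
  shows "S x \<le> S y"
  using assms unfolding riesz_homomorphism_def by (metis sup.absorb_iff2)

lemma riesz_homomorphism_inf:
  assumes S: "riesz_homomorphism S"
  shows "S (inf x y) = inf (S x) (S y)"
proof -
  interpret linear S using S by (simp add: riesz_homomorphism_def)
  have "S (sup (- x) (- y)) = sup (S (- x)) (S (- y))"
    using S by (simp add: riesz_homomorphism_def)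
  then show ?thesis
    by (simp add: inf_eq_neg_sup neg)
qed

context cond_exp_preserving_system
begin

sublocale T: linear T by (rule T_linear)

sublocale S: linear S
  using S_homomorphism by (simp add: riesz_homomorphism_def)

lemma unit_nonneg: "0 \<le> e"
  using weak_order_unit by (simp add: weak_order_unit_def)

lemma T_mono: "x \<le> y \<Longrightarrow> T x \<le> T y"
  using T_strictly_positive unfolding strictly_positive_def
  by (metis T.diff diff_gt_0_iff_gt order_le_less)

text \<open>Turns one-sided estimates into equalities; applied to \<open>p \<le> S p\<close> and to
  \<open>f \<le> T f\<close>.\<close>

lemma eq_if_le_and_T_eq:
  assumes "x \<le> y" "T x = T y"
  shows "x = y"
  using T_strictly_positive assms unfolding strictly_positive_def
  by (metis T.diff diff_gt_0_iff_gt order_le_less diff_self less_irrefl)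

lemma S_sup: "S (sup x y) = sup (S x) (S y)"
  using S_homomorphism by (simp add: riesz_homomorphism_def)

text \<open>\<open>S\<close> fixes every approximant, so by monotonicity its value at the supremum
  can only be larger; \<open>T\<close> does not see the difference.\<close>

lemma S_band_component:
  assumes "S h = h"
  shows "S (band_component e h) = band_component e h"
proof -
  have "inf (real n *\<^sub>R h) e \<le> S (band_component e h)" for n
  proof -
    have "inf (real n *\<^sub>R h) e = S (inf (real n *\<^sub>R h) e)"
      by (simp add: riesz_homomorphism_inf[OF S_homomorphism] S.scaleR assms S_unit)
    also have "\<dots> \<le> S (band_component e h)"
      by (intro riesz_homomorphism_mono[OF S_homomorphism] band_component_upper)
    finally show ?thesis .
  qed
  then have "band_component e h \<le> S (band_component e h)"
    by (rule band_component_least)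
  then show ?thesis
    by (metis eq_if_le_and_T_eq S_preserves)
qed

lemma T_fixes_nonneg_invariant:
  assumes comp: "\<And>p. component_of e p \<Longrightarrow> S p = p \<Longrightarrow> T p = p"
    and f: "0 \<le> f" "S f = f"
  shows "T f = f"
proof -
  have slice_bound: "inf f (real K *\<^sub>R d) \<le> d + T f"
    if m: "0 < m" and d: "d = inverse (real m) *\<^sub>R e" for m K d
  proof -
    define h where "h k = sup (f - real k *\<^sub>R d) 0" for k
    define p where "p k = band_component e (h k)" for k
    define g where "g k = inf (h k) d" for k
    have d0: "0 \<le> d" using unit_nonneg by (simp add: d scaleR_nonneg_nonneg)
    have md: "real m *\<^sub>R d = e" using m by (simp add: d)
    \<comment> \<open>Puts \<open>h (Suc k)\<close> in the form needed to bound slice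
      \<open>k\<close> from below by \<open>p (Suc k)\<close>.\<close>
    have h_Suc: "h (Suc k) = sup (h k - d) 0" for k
    proof -
      have "h k - d = sup (f - real (Suc k) *\<^sub>R d) (- d)"
        using add_sup_distrib_right[of "f - real k *\<^sub>R d" 0 "- d"]
        by (simp add: h_def algebra_simps)
      then show ?thesis
        using d0 by (simp add: h_def sup_assoc sup.absorb2)
    qed
    have "S (h k) = h k" for k
      by (simp add: h_def S_sup S.diff S.scaleR S.zero d S_unit f)
    then have Tp: "T (p k) = p k" for k
      unfolding p_def
      by (intro comp component_of_band_component unit_nonneg S_band_component)
    have upper: "real m *\<^sub>R g k \<le> p k" for k
      unfolding g_def p_def using scaleR_slice_le_band_component[of m "h k" d] by (simp add: md)
    have lower: "p (Suc k) \<le> real m *\<^sub>R g k" for k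
      unfolding g_def p_def h_Suc
      using band_component_le_scaleR_slice[of "h k" d m] d0 by (simp add: md h_def)
    have sum_g: "sum g {..<K} = inf f (real K *\<^sub>R d)"
      unfolding g_def h_def by (rule sum_slices[OF f(1) d0])
    have p_nonneg: "0 \<le> p K"
      unfolding p_def using band_component_upper[of 0 "h K" e] unit_nonneg
      by (simp add: inf.absorb1)
    have p_le: "p 0 \<le> e"
      unfolding p_def by (rule band_component_least) simp
    have "real m *\<^sub>R sum g {..<K} \<le> (\<Sum>k<K. p k)"
      unfolding scaleR_sum_right by (intro sum_mono upper)
    \<comment> \<open>The upper bound on slice \<open>k\<close> uses \<open>p k\<close>, the lower
      one \<open>p (Suc k)\<close>. Adding \<open>p K\<close> and splitting off
      \<open>p 0 \<le> e\<close> shifts the index; the cost \<open>e\<close> becomes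
      \<open>d\<close> after division by \<open>m\<close>.\<close>
    also have "\<dots> \<le> (\<Sum>k<Suc K. p k)"
      using p_nonneg by simp
    also have "\<dots> = p 0 + (\<Sum>k<K. T (p (Suc k)))"
      by (subst sum.lessThan_Suc_shift) (simp add: Tp)
    also have "\<dots> \<le> e + (\<Sum>k<K. T (real m *\<^sub>R g k))"
      by (intro add_mono p_le sum_mono T_mono lower)
    also have "\<dots> = e + real m *\<^sub>R T (sum g {..<K})"
      by (simp add: T.sum T.scaleR scaleR_sum_right)
    also have "\<dots> \<le> e + real m *\<^sub>R T f"
      unfolding sum_g by (intro add_left_mono scaleR_left_mono T_mono) auto
    also have "\<dots> = real m *\<^sub>R (d + T f)"
      by (simp add: scaleR_add_right md)
    finally have "real m *\<^sub>R inf f (real K *\<^sub>R d) \<le> real m *\<^sub>R (d + T f)"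
      by (simp add: sum_g)
    from scaleR_left_mono[OF this, of "inverse (real m)"] m show ?thesis
      by simp
  qed
  have "inf f (real n *\<^sub>R e) \<le> T f" for n
  proof -
    \<comment> \<open>With \<open>m * n\<close> slices of height \<open>e/m\<close> the truncation
      level is \<open>n e\<close> for every \<open>m\<close>, so the Archimedean property removes
      the error.\<close>
    have "real m *\<^sub>R (inf f (real n *\<^sub>R e) - T f) \<le> e" for m
    proof (cases "m = 0")
      case False
      then have m: "0 < m" by simp
      let ?d = "inverse (real m) *\<^sub>R e"
      have "real (m * n) *\<^sub>R ?d = real n *\<^sub>R e" using m by simp
      with slice_bound[OF m refl, of "m * n"]
      have "inf f (real n *\<^sub>R e) - T f \<le> ?d" by (simp only: diff_le_eq)
      from scaleR_left_mono[OF this, of "real m"] m show ?thesis by simp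
    qed (simp add: unit_nonneg)
    from archimedean[OF this] show ?thesis by simp
  qed
  then have "f \<le> T f"
    by (rule le_of_truncations_le[OF weak_order_unit f(1)])
  moreover have "T f = T (T f)"
    using T_projection by (simp add: fun_eq_iff)
  ultimately show ?thesis
    by (metis eq_if_le_and_T_eq)
qed

lemma ergodicI_components:
  assumes comp: "\<And>p. component_of e p \<Longrightarrow> S p = p \<Longrightarrow> T p = p"
  shows "ergodic T S"
  unfolding ergodic_def
proof (intro allI impI)
  fix f assume f: "S f = f"
  have f_eq: "f = sup f 0 - sup (- f) 0"
    using prts[of f] by (simp add: pprt_def nprt_def inf_eq_neg_sup)
  have "T (sup f 0) = sup f 0"
    by (rule T_fixes_nonneg_invariant[OF comp]) (simp_all add: S_sup f S.zero)
  moreover have "T (sup (- f) 0) = sup (- f) 0"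
    by (rule T_fixes_nonneg_invariant[OF comp]) (simp_all add: S_sup f S.zero S.neg)
  ultimately show "T f = f"
    by (metis f_eq T.diff)
qed

end

theorem lemma2:
  fixes T S :: "'a::dedekind_complete_riesz_space \<Rightarrow> 'a" and e :: 'a
  assumes "cond_exp_preserving_system T S e"
  shows "ergodic T S \<longleftrightarrow> (\<forall>p. component_of e p \<longrightarrow> S p = p \<longrightarrow> T p = p)"
  \<comment> \<open>The forward implication is ergodicity applied to \<open>p\<close>
    itself.\<close>
  using cond_exp_preserving_system.ergodicI_components[OF assms]
  by (auto simp: ergodic_def)

end
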